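(* Let $n\ge2$. There exist constants $\epsilon_*>0$, $\phi_*>0$ such that for $|\epsilon|<\epsilon_*$ and $|\phi_0|<\phi_*$ the equation $$-\mathrm i\,\frac{\partial w_j}{\partial t}=-\epsilon(\Delta w)_j-w_j+|w_j|^2w_j,\qquad j=1,\dots,n,$$ has a periodic solution of the form $w_j(t;\phi_0)=e^{\mathrm it\phi_0}p_j(\phi_0)$, with $p(\phi_0)\in\mathbb R^n$, $p_1(\phi_0)=1+\mathcal O(\epsilon,\phi_0)$, and $p_j(\phi_0)=\mathcal O(\epsilon^{j-1})$ for $j=2,\dots,n$.
   Context: The discrete Laplacian on $\mathbb C^n$ is $(\Delta w)_j=w_{j-1}-2w_j+w_{j+1}$ for $1<j<n$, $(\Delta w)_1=-w_1+w_2$, $(\Delta w)_n=-w_n+w_{n-1}$. $\mathcal O(\epsilon,\phi_0)$ means bounded by a constant times $|\epsilon|+|\phi_0|$, and $\mathcal O(\epsilon^{j-1})$ means bounded by a constant times $|\epsilon|^{j-1}$, uniformly in the stated range of parameters. *)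

theory Defs
  imports "HOL-Analysis.Analysis"
begin

text \<open>Vectors of \<open>\<complex>\<^sup>n\<close> are functions \<open>nat \<Rightarrow> complex\<close>, of which only the values at the
  indices \<open>1, \<dots>, n\<close> matter.\<close>

definition discrete_laplacian :: "nat \<Rightarrow> (nat \<Rightarrow> complex) \<Rightarrow> nat \<Rightarrow> complex" where
  "discrete_laplacian n w j =
     (if j = 1 then - w 1 + w 2
      else if j = n then - w n + w (n - 1)
      else w (j - 1) - 2 * w j + w (j + 1))"

definition lattice_solution :: "nat \<Rightarrow> real \<Rightarrow> (real \<Rightarrow> nat \<Rightarrow> complex) \<Rightarrow> bool" where
  "lattice_solution n \<epsilon> w \<longleftrightarrow>
     (\<forall>t. \<forall>j\<in>{1..n}. \<exists>w'. ((\<lambda>s. w s j) has_vector_derivative w') (at t) \<and>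
        - \<i> * w' = - complex_of_real \<epsilon> * discrete_laplacian n (w t) j - w t j
                    + complex_of_real ((cmod (w t j))\<^sup>2) * w t j)"

text \<open>The period need not be minimal, so a constant function counts as periodic; this is what
  happens to \<open>e\<^bsup>it\<phi>\<^esup> p\<close> at \<open>\<phi> = 0\<close>.\<close>

definition time_periodic :: "nat \<Rightarrow> (real \<Rightarrow> nat \<Rightarrow> complex) \<Rightarrow> bool" where
  "time_periodic n w \<longleftrightarrow> (\<exists>T>0. \<forall>t. \<forall>j\<in>{1..n}. w (t + T) j = w t j)"

end

theory Submission
  imports Defs
begin

text \<open>With \<open>w\<^sub>j = e\<^bsup>it\<phi>\<^esup> p\<^sub>j\<close> the equation becomes
  \<open>(1 + \<phi>) p\<^sub>j = p\<^sub>j\<^sup>3 - \<epsilon> (\<Delta>p)\<^sub>j\<close>. The chain is eliminated from its far end: a solution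
  on the sites \<open>j, \<dots>, n\<close> is determined by \<open>p\<^bsub>j-1\<^esub>\<close>, through
  \<open>p\<^sub>j = f\<^sub>j(p\<^bsub>j-1\<^esub>)\<close> with \<open>f\<^sub>j(0) = 0\<close> and \<open>f\<^sub>j\<close> Lipschitz with constant
  \<open>2\<bar>\<epsilon>\<bar>\<close>; the Neumann condition at the far end is the case
  \<open>f\<^bsub>n+1\<^esub> = id\<close>. What remains is one scalar equation for \<open>p\<^sub>1\<close> near \<open>1\<close>, solved by the
  intermediate value theorem, and the decay is \<open>\<bar>p\<^sub>j\<bar> \<le> 2\<bar>\<epsilon>\<bar> \<bar>p\<^bsub>j-1\<^esub>\<bar>\<close>.\<close>

section \<open>Elimination of the sites behind the first one\<close>

text \<open>\<open>a\<close> and \<open>b\<close> are the amplitudes to the left and right of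
  \<open>x\<close>. The last site of the chain is covered as well, by taking
  \<open>b = x\<close>.\<close>

definition site_eq :: "real \<Rightarrow> real \<Rightarrow> real \<Rightarrow> real \<Rightarrow> real \<Rightarrow> bool" where
  "site_eq \<epsilon> \<phi> a x b \<longleftrightarrow> (1 + \<phi>) * x = x ^ 3 - \<epsilon> * (a - 2 * x + b)"

lemma one_lipschitz_abs_diff:
  fixes f :: "real \<Rightarrow> real"
  assumes "1-lipschitz_on {-2..2} f" "\<bar>x\<bar> \<le> 2" "\<bar>y\<bar> \<le> 2"
  shows "\<bar>f x - f y\<bar> \<le> \<bar>x - y\<bar>"
proof -
  have "x \<in> {-2..2}" "y \<in> {-2..2}" using assms by auto
  from lipschitz_onD[OF assms(1) this] show ?thesis by (simp add: dist_real_def)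
qed

text \<open>Subtracting the two equations leaves \<open>x - y\<close> with coefficient 1 against a
  small multiple of itself, which is absorbed on the left. The choice \<open>b = y = 0\<close> turns
  the estimate into a bound on \<open>x\<close> alone.\<close>

lemma site_eq_diff_bound:
  fixes f :: "real \<Rightarrow> real"
  assumes \<epsilon>: "\<bar>\<epsilon>\<bar> \<le> 1/16" and \<phi>: "\<bar>\<phi>\<bar> \<le> 1/16"
    and f: "1-lipschitz_on {-2..2} f"
    and x: "\<bar>x\<bar> \<le> 1/4" and y: "\<bar>y\<bar> \<le> 1/4"
    and eqs: "site_eq \<epsilon> \<phi> a x (f x)" "site_eq \<epsilon> \<phi> b y (f y)"
  shows "\<bar>x - y\<bar> \<le> 2 * \<bar>\<epsilon>\<bar> * \<bar>a - b\<bar>"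
proof -
  define d where "d = \<bar>x - y\<bar>"
  have lip: "\<bar>f x - f y\<bar> \<le> d"
    using one_lipschitz_abs_diff[OF f, of x y] x y by (simp add: d_def)
  \<comment> \<open>The cofactor in \<open>x ^ 3 - y ^ 3 = (x - y) * S\<close>.\<close>
  define S where "S = x\<^sup>2 + x * y + y\<^sup>2"
  have S: "\<bar>S\<bar> \<le> 3/16"
  proof -
    have "\<bar>x\<^sup>2\<bar> \<le> 1/16" "\<bar>y\<^sup>2\<bar> \<le> 1/16" "\<bar>x * y\<bar> \<le> 1/16"
      using mult_mono[of "\<bar>x\<bar>" "1/4" "\<bar>x\<bar>" "1/4"] mult_mono[of "\<bar>y\<bar>" "1/4" "\<bar>y\<bar>" "1/4"]
        mult_mono[of "\<bar>x\<bar>" "1/4" "\<bar>y\<bar>" "1/4"] x y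
      by (auto simp: power2_eq_square abs_mult)
    then show ?thesis unfolding S_def by linarith
  qed
  have eq: "x - y = (S - \<phi>) * (x - y) + (- \<epsilon>) * (a - b) + \<epsilon> * (2 * (x - y) - (f x - f y))"
    using eqs unfolding S_def site_eq_def
    by (simp add: algebra_simps power2_eq_square power3_eq_cube)
  have "\<bar>(S - \<phi>) * (x - y)\<bar> \<le> 1/4 * d"
    unfolding abs_mult d_def using S \<phi> by (intro mult_right_mono) linarith+
  moreover have "\<bar>\<epsilon> * (2 * (x - y) - (f x - f y))\<bar> \<le> 1/16 * (3 * d)"
  proof -
    have "\<bar>2 * (x - y) - (f x - f y)\<bar> \<le> 3 * d"
    proof -
      have "\<bar>2 * u - v\<bar> \<le> 3 * \<bar>u\<bar>" if "\<bar>v\<bar> \<le> \<bar>u\<bar>" for u v :: real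
        using that by linarith
      then show ?thesis using lip unfolding d_def .
    qed
    then show ?thesis unfolding abs_mult using \<epsilon> by (intro mult_mono) auto
  qed
  moreover have "\<bar>(- \<epsilon>) * (a - b)\<bar> = \<bar>\<epsilon>\<bar> * \<bar>a - b\<bar>" by (simp add: abs_mult)
  \<comment> \<open>Here 1 - 1/4 - 3/16 = 9/16 exceeds 1/2, whence the factor 2.\<close>
  ultimately have "d \<le> 1/4 * d + \<bar>\<epsilon>\<bar> * \<bar>a - b\<bar> + 3/16 * d"
    using eq unfolding d_def by linarith
  moreover have "d \<ge> 0" by (simp add: d_def)
  ultimately have "d \<le> 2 * (\<bar>\<epsilon>\<bar> * \<bar>a - b\<bar>)" by linarith
  then show ?thesis by (simp add: d_def)
qed

text \<open>For small parameters the linear term dominates on \<open>{-1/4..1/4}\<close>, so the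
  equation changes sign between the endpoints.\<close>

lemma site_eq_solvable:
  fixes f :: "real \<Rightarrow> real"
  assumes \<epsilon>: "\<bar>\<epsilon>\<bar> \<le> 1/16" and \<phi>: "\<bar>\<phi>\<bar> \<le> 1/16"
    and f: "1-lipschitz_on {-2..2} f" and f0: "f 0 = 0" and a: "\<bar>a\<bar> \<le> 2"
  shows "\<exists>x. \<bar>x\<bar> \<le> 1/4 \<and> site_eq \<epsilon> \<phi> a x (f x)"
proof -
  define r where "r x = \<epsilon> * (a - 2 * x + f x)" for x
  define h where "h x = (1 + \<phi>) * x - x ^ 3 + r x" for x
  have cont: "continuous_on {-1/4..1/4} h"
    unfolding h_def r_def
    by (intro continuous_intros continuous_on_subset[OF lipschitz_on_continuous_on[OF f]]) auto
  have bnd: "\<bar>r x\<bar> \<le> 11/64" if "\<bar>x\<bar> = 1/4" for x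
  proof -
    have "\<bar>f x\<bar> \<le> 1/4"
      using one_lipschitz_abs_diff[OF f, of x 0] f0 that by auto
    then have "\<bar>a - 2 * x + f x\<bar> \<le> 11/4" using a that by linarith
    then have "\<bar>r x\<bar> \<le> 1/16 * (11/4)"
      unfolding r_def abs_mult using \<epsilon> by (intro mult_mono) auto
    then show ?thesis by simp
  qed
  \<comment> \<open>The term \<open>\<phi>/4\<close> is at most 1/64 in absolute value, so 15/64
    outweighs it together with the coupling bound 11/64 = 1/16 * (2 + 1/2 + 1/4).\<close>
  have "h (-1/4) = -15/64 - \<phi>/4 + r (-1/4)" "h (1/4) = 15/64 + \<phi>/4 + r (1/4)"
    by (simp_all add: h_def power3_eq_cube field_simps)
  moreover have "\<bar>r (-1/4)\<bar> \<le> 11/64" "\<bar>r (1/4)\<bar> \<le> 11/64"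
    using bnd[of "-1/4"] bnd[of "1/4"] by simp_all
  ultimately have "h (-1/4) \<le> 0" "0 \<le> h (1/4)"
    using \<phi> by linarith+
  from IVT'[OF this _ cont] obtain x where "-1/4 \<le> x" "x \<le> 1/4" "h x = 0" by auto
  then show ?thesis
    by (intro exI[of _ x]) (auto simp: h_def r_def site_eq_def)
qed

text \<open>The map \<open>g\<close> inherits the properties required of \<open>f\<close>, because
  its Lipschitz constant \<open>2 * \<bar>\<epsilon>\<bar>\<close> is at most 1/8. This is what lets
  the elimination be iterated.\<close>

lemma site_response:
  fixes f :: "real \<Rightarrow> real"
  assumes \<epsilon>: "\<bar>\<epsilon>\<bar> \<le> 1/16" and \<phi>: "\<bar>\<phi>\<bar> \<le> 1/16"
    and f: "1-lipschitz_on {-2..2} f" and f0: "f 0 = 0"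
  obtains g where "g 0 = 0" "1-lipschitz_on {-2..2} g"
    "\<And>a. \<bar>a\<bar> \<le> 2 \<Longrightarrow> \<bar>g a\<bar> \<le> 2 * \<bar>\<epsilon>\<bar> * \<bar>a\<bar> \<and> site_eq \<epsilon> \<phi> a (g a) (f (g a))"
proof -
  obtain g where g: "\<And>a. \<bar>a\<bar> \<le> 2 \<Longrightarrow> \<bar>g a\<bar> \<le> 1/4 \<and> site_eq \<epsilon> \<phi> a (g a) (f (g a))"
    using site_eq_solvable[OF \<epsilon> \<phi> f f0] by metis
  have diff: "\<bar>g a - g b\<bar> \<le> 2 * \<bar>\<epsilon>\<bar> * \<bar>a - b\<bar>" if "\<bar>a\<bar> \<le> 2" "\<bar>b\<bar> \<le> 2" for a b
    using site_eq_diff_bound[OF \<epsilon> \<phi> f] g that by blast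
  \<comment> \<open>Comparison with the zero solution: since \<open>f 0 = 0\<close>, the value 0
    solves the site equation with left neighbour 0.\<close>
  have bound: "\<bar>g a\<bar> \<le> 2 * \<bar>\<epsilon>\<bar> * \<bar>a\<bar>" if "\<bar>a\<bar> \<le> 2" for a
    using site_eq_diff_bound[OF \<epsilon> \<phi> f, of "g a" 0 a 0] g[OF that] f0
    by (simp add: site_eq_def)
  have "1-lipschitz_on {-2..2} g"
  proof (rule lipschitz_onI)
    fix a b :: real assume "a \<in> {-2..2}" "b \<in> {-2..2}"
    then have "\<bar>g a - g b\<bar> \<le> 2 * \<bar>\<epsilon>\<bar> * \<bar>a - b\<bar>" by (intro diff) auto
    also have "\<dots> \<le> 1 * \<bar>a - b\<bar>" using \<epsilon> by (intro mult_right_mono) auto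
    finally show "dist (g a) (g b) \<le> 1 * dist a b" by (simp add: dist_real_def)
  qed simp
  with bound[of 0] bound g show ?thesis by (intro that[of g]) auto
qed

text \<open>Induction on the number \<open>m\<close> of sites in the block \<open>q 1\<close>, ...,
  \<open>q m\<close>, adding each new site at the front. \<open>q 0\<close> is the neighbour before
  the block, and \<open>q (Suc m) = q m\<close> is a ghost site that encodes the end
  condition.\<close>

lemma chain_response:
  assumes \<epsilon>: "\<bar>\<epsilon>\<bar> \<le> 1/16" and \<phi>: "\<bar>\<phi>\<bar> \<le> 1/16"
  shows "\<exists>f. f 0 = 0 \<and> 1-lipschitz_on {-2..2} f \<and>
    (\<forall>a. \<bar>a\<bar> \<le> 2 \<longrightarrow> (\<exists>q. q 0 = a \<and> q 1 = f a \<and> q (Suc m) = q m \<and>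
      (\<forall>i<m. site_eq \<epsilon> \<phi> (q i) (q (Suc i)) (q (Suc (Suc i))) \<and>
        \<bar>q (Suc i)\<bar> \<le> 2 * \<bar>\<epsilon>\<bar> * \<bar>q i\<bar>)))"
proof (induction m)
  case 0
  \<comment> \<open>In an empty block the ghost site repeats \<open>q 0\<close> itself, so the
    response is the identity and \<open>q\<close> is constant.\<close>
  show ?case
    by (rule exI[of _ "\<lambda>x. x"]) (auto intro!: lipschitz_onI exI[of _ "\<lambda>_::nat. _"])
next
  case (Suc m)
  then obtain f where f0: "f 0 = 0" and f: "1-lipschitz_on {-2..2} f"
    and chain: "\<And>a. \<bar>a\<bar> \<le> 2 \<Longrightarrow> \<exists>q. q 0 = a \<and> q 1 = f a \<and> q (Suc m) = q m \<and>
      (\<forall>i<m. site_eq \<epsilon> \<phi> (q i) (q (Suc i)) (q (Suc (Suc i))) \<and>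
        \<bar>q (Suc i)\<bar> \<le> 2 * \<bar>\<epsilon>\<bar> * \<bar>q i\<bar>)" by blast
  obtain g where g0: "g 0 = 0" and glip: "1-lipschitz_on {-2..2} g"
    and g: "\<And>a. \<bar>a\<bar> \<le> 2 \<Longrightarrow> \<bar>g a\<bar> \<le> 2 * \<bar>\<epsilon>\<bar> * \<bar>a\<bar> \<and> site_eq \<epsilon> \<phi> a (g a) (f (g a))"
    using site_response[OF \<epsilon> \<phi> f f0] by blast
  have "\<exists>q. q 0 = a \<and> q 1 = g a \<and> q (Suc (Suc m)) = q (Suc m) \<and>
      (\<forall>i<Suc m. site_eq \<epsilon> \<phi> (q i) (q (Suc i)) (q (Suc (Suc i))) \<and>
        \<bar>q (Suc i)\<bar> \<le> 2 * \<bar>\<epsilon>\<bar> * \<bar>q i\<bar>)" if a: "\<bar>a\<bar> \<le> 2" for a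
  proof -
    \<comment> \<open>The new value is at most 1/4, so it is an admissible input for the shorter
      block.\<close>
    have "2 * \<bar>\<epsilon>\<bar> * \<bar>a\<bar> \<le> 2 * (1/16) * 2"
      using \<epsilon> a by (intro mult_mono) auto
    then have "\<bar>g a\<bar> \<le> 2" using g[OF a] by linarith
    from chain[OF this] obtain q where q: "q 0 = g a" "q 1 = f (g a)" "q (Suc m) = q m"
      "\<And>i. i < m \<Longrightarrow> site_eq \<epsilon> \<phi> (q i) (q (Suc i)) (q (Suc (Suc i))) \<and>
        \<bar>q (Suc i)\<bar> \<le> 2 * \<bar>\<epsilon>\<bar> * \<bar>q i\<bar>" by blast
    show ?thesis
      by (rule exI[of _ "case_nat a q"])
        (use q g[OF a] in \<open>auto simp: less_Suc_eq_0_disj\<close>)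
  qed
  with g0 glip show ?case by blast
qed

section \<open>The scalar equation at the first site\<close>

text \<open>A perturbation of \<open>x ^ 3 = x\<close> near the root 1. The interval
  \<open>{1/2..3/2}\<close> excludes the roots 0 and -1, so the cubic changes sign there and a
  factor \<open>x\<close> can be cancelled in the error estimate.\<close>

lemma first_site_solvable:
  fixes f :: "real \<Rightarrow> real"
  assumes \<epsilon>: "\<bar>\<epsilon>\<bar> \<le> 1/16" and \<phi>: "\<bar>\<phi>\<bar> \<le> 1/16"
    and f: "1-lipschitz_on {-2..2} f" and f0: "f 0 = 0"
  obtains x where "1/2 \<le> x" "x \<le> 3/2" "(1 + \<phi>) * x = x ^ 3 - \<epsilon> * (- x + f x)"
    "\<bar>x - 1\<bar> \<le> 2 * (\<bar>\<epsilon>\<bar> + \<bar>\<phi>\<bar>)"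
proof -
  define r where "r x = \<epsilon> * (- x + f x)" for x
  define h where "h x = x ^ 3 - (1 + \<phi>) * x - r x" for x
  have cont: "continuous_on {1/2..3/2} h"
    unfolding h_def r_def
    by (intro continuous_intros continuous_on_subset[OF lipschitz_on_continuous_on[OF f]]) auto
  have bnd: "\<bar>r x\<bar> \<le> \<bar>\<epsilon>\<bar> * (2 * x)" if "1/2 \<le> x" "x \<le> 3/2" for x
  proof -
    have "\<bar>f x\<bar> \<le> x"
      using one_lipschitz_abs_diff[OF f, of x 0] f0 that by auto
    then show ?thesis unfolding r_def abs_mult using that by (intro mult_left_mono) auto
  qed
  have "h (1/2) = -3/8 - \<phi>/2 - r (1/2)" "h (3/2) = 15/8 - 3/2 * \<phi> - r (3/2)"
    by (simp_all add: h_def power3_eq_cube field_simps)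
  moreover have "\<bar>r (1/2)\<bar> \<le> \<bar>\<epsilon>\<bar>" "\<bar>r (3/2)\<bar> \<le> 3 * \<bar>\<epsilon>\<bar>"
    using bnd[of "1/2"] bnd[of "3/2"] by simp_all
  ultimately have "h (1/2) \<le> 0" "0 \<le> h (3/2)"
    using \<epsilon> \<phi> by linarith+
  from IVT'[OF this _ cont] obtain x where x: "1/2 \<le> x" "x \<le> 3/2" and hx: "h x = 0" by auto
  \<comment> \<open>The distance to 1 is read off from the factorization of
    \<open>x ^ 3 - x\<close>: cancel \<open>x\<close>, then use
    \<open>x + 1 \<ge> 1\<close>.\<close>
  have "\<bar>x - 1\<bar> * (x + 1) * x = \<bar>(x - 1) * (x + 1) * x\<bar>"
    using x by (simp add: abs_mult)
  also have "(x - 1) * (x + 1) * x = \<phi> * x + r x"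
    using hx by (simp add: h_def algebra_simps power3_eq_cube)
  also have "\<bar>\<dots>\<bar> \<le> \<bar>\<phi>\<bar> * x + \<bar>\<epsilon>\<bar> * (2 * x)"
    using abs_triangle_ineq[of "\<phi> * x" "r x"] bnd[OF x] x by (simp add: abs_mult)
  also have "\<dots> \<le> 2 * (\<bar>\<epsilon>\<bar> + \<bar>\<phi>\<bar>) * x"
    using x by (simp add: algebra_simps)
  finally have "\<bar>x - 1\<bar> * (x + 1) \<le> 2 * (\<bar>\<epsilon>\<bar> + \<bar>\<phi>\<bar>)" using x by simp
  moreover have "\<bar>x - 1\<bar> \<le> \<bar>x - 1\<bar> * (x + 1)"
    using x mult_left_mono[of 1 "x + 1" "\<bar>x - 1\<bar>"] by simp
  ultimately have "\<bar>x - 1\<bar> \<le> 2 * (\<bar>\<epsilon>\<bar> + \<bar>\<phi>\<bar>)"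
    by (rule order_trans[rotated])
  with x hx show ?thesis by (intro that[of x]) (auto simp: h_def r_def)
qed

section \<open>The real stationary profile\<close>

definition real_laplacian :: "nat \<Rightarrow> (nat \<Rightarrow> real) \<Rightarrow> nat \<Rightarrow> real" where
  "real_laplacian n p j =
     (if j = 1 then - p 1 + p 2
      else if j = n then - p n + p (n - 1)
      else p (j - 1) - 2 * p j + p (j + 1))"

lemma discrete_laplacian_phase:
  "discrete_laplacian n (\<lambda>j. c * complex_of_real (p j)) j = c * complex_of_real (real_laplacian n p j)"
  by (auto simp: discrete_laplacian_def real_laplacian_def algebra_simps)

text \<open>The first-site solution is the input to the response of the remaining
  \<open>n - 1\<close> sites. The decay follows by iterating the one-step bound, and the leading
  factor 2 covers \<open>q 0 \<le> 3/2\<close>.\<close>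

lemma stationary_profile:
  assumes \<epsilon>: "\<bar>\<epsilon>\<bar> \<le> 1/16" and \<phi>: "\<bar>\<phi>\<bar> \<le> 1/16" and n: "n \<ge> 2"
  shows "\<exists>p. (\<forall>j\<in>{1..n}. (1 + \<phi>) * p j = p j ^ 3 - \<epsilon> * real_laplacian n p j) \<and>
    \<bar>p 1 - 1\<bar> \<le> 2 * (\<bar>\<epsilon>\<bar> + \<bar>\<phi>\<bar>) \<and>
    (\<forall>j\<in>{1..n}. \<bar>p j\<bar> \<le> 2 * 2 ^ (j - 1) * \<bar>\<epsilon>\<bar> ^ (j - 1))"
proof -
  define m where "m = n - 1"
  obtain f where f0: "f 0 = 0" and f: "1-lipschitz_on {-2..2} f"
    and chain: "\<And>a. \<bar>a\<bar> \<le> 2 \<Longrightarrow> \<exists>q. q 0 = a \<and> q 1 = f a \<and> q (Suc m) = q m \<and>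
      (\<forall>i<m. site_eq \<epsilon> \<phi> (q i) (q (Suc i)) (q (Suc (Suc i))) \<and>
        \<bar>q (Suc i)\<bar> \<le> 2 * \<bar>\<epsilon>\<bar> * \<bar>q i\<bar>)"
    using chain_response[OF \<epsilon> \<phi>, of m] by blast
  obtain x where x: "1/2 \<le> x" "x \<le> 3/2" "(1 + \<phi>) * x = x ^ 3 - \<epsilon> * (- x + f x)"
    "\<bar>x - 1\<bar> \<le> 2 * (\<bar>\<epsilon>\<bar> + \<bar>\<phi>\<bar>)"
    using first_site_solvable[OF \<epsilon> \<phi> f f0] by blast
  then have "\<bar>x\<bar> \<le> 2" by auto
  from chain[OF this] obtain q where q: "q 0 = x" "q 1 = f x" "q (Suc m) = q m"
    and site: "\<And>i. i < m \<Longrightarrow> site_eq \<epsilon> \<phi> (q i) (q (Suc i)) (q (Suc (Suc i)))"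
    and step: "\<And>i. i < m \<Longrightarrow> \<bar>q (Suc i)\<bar> \<le> 2 * \<bar>\<epsilon>\<bar> * \<bar>q i\<bar>" by blast
  have decay: "\<bar>q i\<bar> \<le> 2 * 2 ^ i * \<bar>\<epsilon>\<bar> ^ i" if "i \<le> m" for i
    using that
  proof (induction i)
    case 0
    then show ?case using q x by simp
  next
    case (Suc i)
    then have "\<bar>q (Suc i)\<bar> \<le> 2 * \<bar>\<epsilon>\<bar> * \<bar>q i\<bar>" using step by simp
    also have "\<dots> \<le> 2 * \<bar>\<epsilon>\<bar> * (2 * 2 ^ i * \<bar>\<epsilon>\<bar> ^ i)"
      using Suc by (intro mult_left_mono) auto
    finally show ?case by (simp add: algebra_simps)
  qed
  \<comment> \<open>Sites count from 1, whereas \<open>q\<close> starts at index 0 with the first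
    site.\<close>
  define p where "p j = q (j - 1)" for j
  have eq: "(1 + \<phi>) * p j = p j ^ 3 - \<epsilon> * real_laplacian n p j" if j: "j \<in> {1..n}" for j
  proof (cases "j = 1")
    case True
    then show ?thesis using x q by (simp add: p_def real_laplacian_def)
  next
    case False
    with j obtain i where i: "j = Suc (Suc i)" "i < m"
      by (cases j; cases "j - 1") (auto simp: m_def)
    have "real_laplacian n p j = q i - 2 * q (Suc i) + q (Suc (Suc i))"
    \<comment> \<open>At the last site the ghost value \<open>q (Suc m) = q m\<close> reduces the
      interior formula to the boundary one.\<close>
    proof (cases "j = n")
      case True
      then have "m = Suc i" using i by (simp add: m_def)
      then show ?thesis using q(3) i True[symmetric] by (simp add: p_def real_laplacian_def)
    next
      case False
      then show ?thesis using i by (simp add: p_def real_laplacian_def)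
    qed
    then show ?thesis using site[OF i(2)] i by (simp add: p_def site_eq_def)
  qed
  show ?thesis
  proof (intro exI[of _ p] conjI ballI)
    show "\<bar>p 1 - 1\<bar> \<le> 2 * (\<bar>\<epsilon>\<bar> + \<bar>\<phi>\<bar>)" using x q by (simp add: p_def)
    show "\<bar>p j\<bar> \<le> 2 * 2 ^ (j - 1) * \<bar>\<epsilon>\<bar> ^ (j - 1)" if "j \<in> {1..n}" for j
    proof -
      have "j - 1 \<le> m" using that by (auto simp: m_def)
      then show ?thesis unfolding p_def by (rule decay)
    qed
  qed (rule eq)
qed

section \<open>From the profile to a periodic solution\<close>

text \<open>Gauge invariance: a common phase of modulus 1 passes through the Laplacian and the cubic
  term, while \<open>- \<i>\<close> times the time derivative multiplies by
  \<open>\<phi>\<close>.\<close>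

lemma lattice_solution_phase:
  assumes "\<And>j. j \<in> {1..n} \<Longrightarrow> (1 + \<phi>) * p j = p j ^ 3 - \<epsilon> * real_laplacian n p j"
  shows "lattice_solution n \<epsilon> (\<lambda>t j. exp (\<i> * complex_of_real (t * \<phi>)) * complex_of_real (p j))"
  unfolding lattice_solution_def
proof (intro allI ballI)
  fix t :: real and j assume j: "j \<in> {1..n}"
  define E where "E = exp (\<i> * complex_of_real (t * \<phi>))"
  \<comment> \<open>Differentiated in a complex variable first, then restricted to real
    time.\<close>
  have "((\<lambda>z. exp (\<i> * (z * complex_of_real \<phi>)) * complex_of_real (p j))
      has_field_derivative \<i> * complex_of_real \<phi> * (E * complex_of_real (p j))) (at (complex_of_real t))"
    by (auto intro!: derivative_eq_intros simp: E_def)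
  from has_vector_derivative_real_field[OF this]
  have deriv: "((\<lambda>s. exp (\<i> * complex_of_real (s * \<phi>)) * complex_of_real (p j))
      has_vector_derivative \<i> * complex_of_real \<phi> * (E * complex_of_real (p j))) (at t)"
    by simp
  have "\<phi> * p j = - \<epsilon> * real_laplacian n p j - p j + (p j)\<^sup>2 * p j"
    using assms[OF j] by (simp add: algebra_simps power2_eq_square power3_eq_cube)
  then have "complex_of_real (\<phi> * p j) =
      complex_of_real (- \<epsilon> * real_laplacian n p j - p j + (p j)\<^sup>2 * p j)" by simp
  then have "E * complex_of_real (\<phi> * p j) =
      E * complex_of_real (- \<epsilon> * real_laplacian n p j - p j + (p j)\<^sup>2 * p j)" by simp
  then have "- \<i> * (\<i> * complex_of_real \<phi> * (E * complex_of_real (p j))) =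
      - complex_of_real \<epsilon> * discrete_laplacian n (\<lambda>j. E * complex_of_real (p j)) j
      - E * complex_of_real (p j)
      + complex_of_real ((cmod (E * complex_of_real (p j)))\<^sup>2) * (E * complex_of_real (p j))"
    unfolding discrete_laplacian_phase by (simp add: E_def norm_mult algebra_simps)
  with deriv show "\<exists>w'. ((\<lambda>s. exp (\<i> * complex_of_real (s * \<phi>)) * complex_of_real (p j))
        has_vector_derivative w') (at t) \<and>
      - \<i> * w' = - complex_of_real \<epsilon> *
          discrete_laplacian n (\<lambda>j. exp (\<i> * complex_of_real (t * \<phi>)) * complex_of_real (p j)) j
        - exp (\<i> * complex_of_real (t * \<phi>)) * complex_of_real (p j)
        + complex_of_real ((cmod (exp (\<i> * complex_of_real (t * \<phi>)) * complex_of_real (p j)))\<^sup>2)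
          * (exp (\<i> * complex_of_real (t * \<phi>)) * complex_of_real (p j))"
    unfolding E_def by blast
qed

text \<open>The period is \<open>2 * pi / \<bar>\<phi>\<bar>\<close>; for \<open>\<phi> = 0\<close>
  the motion is constant and 1 serves as a period.\<close>

lemma time_periodic_phase:
  "time_periodic n (\<lambda>t j. exp (\<i> * complex_of_real (t * \<phi>)) * complex_of_real (p j))"
proof (cases "\<phi> = 0")
  case True
  then show ?thesis unfolding time_periodic_def by (intro exI[of _ 1]) auto
next
  case False
  define T where "T = 2 * pi / \<bar>\<phi>\<bar>"
  have "exp (\<i> * complex_of_real (T * \<phi>)) = 1"
  proof (cases "\<phi> > 0")
    case True
    then have "\<i> * complex_of_real (T * \<phi>) = 2 * complex_of_real pi * \<i>" by (simp add: T_def)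
    then show ?thesis by (simp only: exp_two_pi_i)
  next
    case False
    with \<open>\<phi> \<noteq> 0\<close> have "\<i> * complex_of_real (T * \<phi>) = - (2 * complex_of_real pi * \<i>)"
      by (simp add: T_def)
    then show ?thesis by (simp only: exp_minus exp_two_pi_i inverse_1)
  qed
  then have "exp (\<i> * complex_of_real ((t + T) * \<phi>)) = exp (\<i> * complex_of_real (t * \<phi>))" for t
    by (simp add: distrib_right distrib_left exp_add)
  moreover have "T > 0" using False by (simp add: T_def)
  ultimately show ?thesis unfolding time_periodic_def by (intro exI[of _ T]) auto
qed

theorem theorem1p6:
  fixes n :: nat
  assumes "n \<ge> 2"
  shows "\<exists>\<epsilon>\<^sub>s>0. \<exists>\<phi>\<^sub>s>0. \<exists>p :: real \<Rightarrow> real \<Rightarrow> nat \<Rightarrow> real.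
    (\<forall>\<epsilon> \<phi>\<^sub>0. \<bar>\<epsilon>\<bar> < \<epsilon>\<^sub>s \<longrightarrow> \<bar>\<phi>\<^sub>0\<bar> < \<phi>\<^sub>s \<longrightarrow>
       (\<exists>w. (\<forall>t. \<forall>j\<in>{1..n}. w t j = exp (\<i> * complex_of_real (t * \<phi>\<^sub>0)) * complex_of_real (p \<epsilon> \<phi>\<^sub>0 j))
          \<and> lattice_solution n \<epsilon> w \<and> time_periodic n w)) \<and>
    (\<exists>C. \<forall>\<epsilon> \<phi>\<^sub>0. \<bar>\<epsilon>\<bar> < \<epsilon>\<^sub>s \<longrightarrow> \<bar>\<phi>\<^sub>0\<bar> < \<phi>\<^sub>s \<longrightarrow> \<bar>p \<epsilon> \<phi>\<^sub>0 1 - 1\<bar> \<le> C * (\<bar>\<epsilon>\<bar> + \<bar>\<phi>\<^sub>0\<bar>)) \<and>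
    (\<forall>j\<in>{2..n}. \<exists>C. \<forall>\<epsilon> \<phi>\<^sub>0. \<bar>\<epsilon>\<bar> < \<epsilon>\<^sub>s \<longrightarrow> \<bar>\<phi>\<^sub>0\<bar> < \<phi>\<^sub>s \<longrightarrow> \<bar>p \<epsilon> \<phi>\<^sub>0 j\<bar> \<le> C * \<bar>\<epsilon>\<bar> ^ (j - 1))"
proof -
  define P where "P \<epsilon> \<phi> p \<longleftrightarrow>
    (\<forall>j\<in>{1..n}. (1 + \<phi>) * p j = p j ^ 3 - \<epsilon> * real_laplacian n p j) \<and>
    \<bar>p 1 - 1\<bar> \<le> 2 * (\<bar>\<epsilon>\<bar> + \<bar>\<phi>\<bar>) \<and>
    (\<forall>j\<in>{1..n}. \<bar>p j\<bar> \<le> 2 * 2 ^ (j - 1) * \<bar>\<epsilon>\<bar> ^ (j - 1))" for \<epsilon> \<phi> :: real and p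
  \<comment> \<open>One profile is fixed for each parameter pair, since the bounds must hold for a
    single family \<open>p\<close>. The constants in \<open>P\<close> depend on neither parameter,
    which gives the uniformity.\<close>
  define p where "p \<epsilon> \<phi> = (SOME q. P \<epsilon> \<phi> q)" for \<epsilon> \<phi>
  have p: "P \<epsilon> \<phi> (p \<epsilon> \<phi>)" if "\<bar>\<epsilon>\<bar> < 1/16" "\<bar>\<phi>\<bar> < 1/16" for \<epsilon> \<phi>
  proof -
    have "\<exists>q. P \<epsilon> \<phi> q"
      unfolding P_def using that by (intro stationary_profile[OF _ _ assms]) auto
    then show ?thesis unfolding p_def by (rule someI_ex)
  qed
  show ?thesis
  proof (rule exI[of _ "1/16"], rule conjI, simp, rule exI[of _ "1/16"], rule conjI, simp,
      rule exI[of _ p], intro conjI allI impI ballI)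
    fix \<epsilon> \<phi> :: real assume "\<bar>\<epsilon>\<bar> < 1/16" "\<bar>\<phi>\<bar> < 1/16"
    then have "P \<epsilon> \<phi> (p \<epsilon> \<phi>)" by (rule p)
    then have sol: "lattice_solution n \<epsilon>
        (\<lambda>t j. exp (\<i> * complex_of_real (t * \<phi>)) * complex_of_real (p \<epsilon> \<phi> j))"
      by (intro lattice_solution_phase) (simp add: P_def)
    show "\<exists>w. (\<forall>t. \<forall>j\<in>{1..n}. w t j = exp (\<i> * complex_of_real (t * \<phi>)) * complex_of_real (p \<epsilon> \<phi> j))
        \<and> lattice_solution n \<epsilon> w \<and> time_periodic n w"
      by (rule exI, intro conjI, rule allI, rule ballI, rule refl, rule sol, rule time_periodic_phase)
  next
    show "\<exists>C. \<forall>\<epsilon> \<phi>. \<bar>\<epsilon>\<bar> < 1/16 \<longrightarrow> \<bar>\<phi>\<bar> < 1/16 \<longrightarrow> \<bar>p \<epsilon> \<phi> 1 - 1\<bar> \<le> C * (\<bar>\<epsilon>\<bar> + \<bar>\<phi>\<bar>)"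
      using p unfolding P_def by blast
  next
    fix j assume "j \<in> {2..n}"
    then have "j \<in> {1..n}" by simp
    then show "\<exists>C. \<forall>\<epsilon> \<phi>. \<bar>\<epsilon>\<bar> < 1/16 \<longrightarrow> \<bar>\<phi>\<bar> < 1/16 \<longrightarrow> \<bar>p \<epsilon> \<phi> j\<bar> \<le> C * \<bar>\<epsilon>\<bar> ^ (j - 1)"
      using p unfolding P_def by blast
  qed
qed

end
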